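(* For any integer $1\leq p\leq \binom{n}{2}$, there exist an undirected weighted graph $G$ on $\Theta(n)$ nodes and a set $P$ of $p$ node pairs such that every $1$-FT $P$-pairwise preserver of $G$ contains $\Omega(\min(np,n^2))$ edges.
   Context: A subgraph $H\subseteq G=(V,E)$ is a $1$-FT $P$-pairwise preserver if $\mathrm{dist}_{H\setminus F}(s,t)=\mathrm{dist}_{G\setminus F}(s,t)$ for every $(s,t)\in P$ and every $F\subseteq E$ with $|F|\leq 1$. Here $n$ denotes (up to a constant factor) the number of nodes of the graph. *)

theory Defs
  imports Complex_Main "HOL-Library.Extended_Real"
begin

text \<open>Finite simple undirected graphs with positive real edge weights. An edge is the
  two-element set of its endpoints, so each undirected edge is counted once.\<close>

record 'a wgraph =
  verts :: "'a set"
  edges :: "'a set set"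
  weight :: "'a set \<Rightarrow> real"

definition weighted_graph :: "'a wgraph \<Rightarrow> bool" where
  "weighted_graph G \<longleftrightarrow> finite (verts G)
     \<and> (\<forall>e\<in>edges G. e \<subseteq> verts G \<and> card e = 2 \<and> 0 < weight G e)"

definition subgraph :: "'a wgraph \<Rightarrow> 'a wgraph \<Rightarrow> bool" where
  "subgraph H G \<longleftrightarrow> weighted_graph H \<and> verts H \<subseteq> verts G \<and> edges H \<subseteq> edges G
     \<and> (\<forall>e\<in>edges H. weight H e = weight G e)"

definition del_edges :: "'a wgraph \<Rightarrow> 'a set set \<Rightarrow> 'a wgraph" where
  "del_edges G F = G\<lparr>edges := edges G - F\<rparr>"

definition walk :: "'a wgraph \<Rightarrow> 'a \<Rightarrow> 'a list \<Rightarrow> 'a \<Rightarrow> bool" where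
  "walk G s xs t \<longleftrightarrow> xs \<noteq> [] \<and> hd xs = s \<and> last xs = t \<and> set xs \<subseteq> verts G
     \<and> successively (\<lambda>u v. {u, v} \<in> edges G) xs"

fun walk_weight :: "'a wgraph \<Rightarrow> 'a list \<Rightarrow> real" where
  "walk_weight G (u # v # xs) = weight G {u, v} + walk_weight G (v # xs)"
| "walk_weight G _ = 0"

text \<open>The distance is \<open>\<infinity>\<close> (the infimum of the empty set) if \<open>t\<close> is not reachable from \<open>s\<close>.\<close>

definition gdist :: "'a wgraph \<Rightarrow> 'a \<Rightarrow> 'a \<Rightarrow> ereal" where
  "gdist G s t = (INF xs\<in>{xs. walk G s xs t}. ereal (walk_weight G xs))"

text \<open>Each unordered pair of distinct nodes may be listed in at most one orientation, so
  that \<open>card P\<close> is the number of unordered pairs.\<close>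

definition node_pairs :: "'a wgraph \<Rightarrow> ('a \<times> 'a) set \<Rightarrow> bool" where
  "node_pairs G P \<longleftrightarrow> P \<subseteq> verts G \<times> verts G \<and> (\<forall>(s, t)\<in>P. s \<noteq> t \<and> (t, s) \<notin> P)"

definition ft_pairwise_preserver ::
  "nat \<Rightarrow> 'a wgraph \<Rightarrow> ('a \<times> 'a) set \<Rightarrow> 'a wgraph \<Rightarrow> bool" where
  "ft_pairwise_preserver f G P H \<longleftrightarrow> subgraph H G
     \<and> (\<forall>(s, t)\<in>P. \<forall>F. F \<subseteq> edges G \<and> finite F \<and> card F \<le> f \<longrightarrow>
          gdist (del_edges H F) s t = gdist (del_edges G F) s t)"

end

theory Submission
  imports Defs
begin

text \<open>Take a path \<open>0, \<dots>, n\<close> of unit edges and join every path node \<open>k\<close> to each of \<open>n\<close> further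
  nodes \<open>x\<close> by an edge of weight \<open>4n - 2k\<close>. Going from \<open>0\<close> to \<open>x\<close> along the path up to \<open>k\<close> costs
  \<open>4n - k\<close>, so it pays to leave the path as late as possible; a detour through a second node \<open>x'\<close>
  is too expensive. Hence if the path edge \<open>{j, j + 1}\<close> fails, the edge \<open>{j, x}\<close> is
  indispensable for the pair \<open>(0, x)\<close>, and every such pair forces \<open>n\<close> edges of its own.\<close>

lemma walk_weight_append_single:
  "xs \<noteq> [] \<Longrightarrow> walk_weight G (xs @ [v]) = walk_weight G xs + weight G {last xs, v}"
  by (induction G xs rule: walk_weight.induct) auto

lemma walk_append_single:
  assumes "walk G s xs u" "{u, v} \<in> edges G" "v \<in> verts G"
  shows "walk G s (xs @ [v]) v"
  using assms by (auto simp: walk_def successively_append_iff)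

text \<open>The increments of \<phi> telescope along the walk. Since \<open>{u, v} = {v, u}\<close>,
  the assumption bounds the change of \<phi> in both directions of an edge.\<close>

lemma potential_le_walk_weight:
  fixes \<phi> :: "'a \<Rightarrow> real"
  assumes "\<And>u v. {u, v} \<in> edges G \<Longrightarrow> \<phi> v - \<phi> u \<le> weight G {u, v}"
    and "xs \<noteq> []" "successively (\<lambda>u v. {u, v} \<in> edges G) xs"
  shows "\<phi> (last xs) - \<phi> (hd xs) \<le> walk_weight G xs"
  using assms(2,3)
proof (induction xs rule: induct_list012)
  case (3 u v xs)
  then have "\<phi> (last (v # xs)) - \<phi> v \<le> walk_weight G (v # xs)" and "{u, v} \<in> edges G"
    by auto
  with assms(1)[of u v] show ?case by auto
qed auto

text \<open>A potential certifies a lower bound on the distance without any classification of walks;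
  if \<open>t\<close> is unreachable, the infimum is \<infinity> and the bound still holds.\<close>

lemma potential_le_gdist:
  fixes \<phi> :: "'a \<Rightarrow> real"
  assumes "\<And>u v. {u, v} \<in> edges G \<Longrightarrow> \<phi> v - \<phi> u \<le> weight G {u, v}"
  shows "ereal (\<phi> t - \<phi> s) \<le> gdist G s t"
  unfolding gdist_def
  using potential_le_walk_weight[of G \<phi>, OF assms] by (intro INF_greatest) (auto simp: walk_def)

text \<open>Nodes above \<open>n\<close> are the far ends of the spokes, so
  \<open>Max e \<le> n\<close> singles out path edges, and \<open>Min e\<close> is the path end of a
  spoke.\<close>

definition fan_graph :: "nat \<Rightarrow> nat wgraph" where
  "fan_graph n = \<lparr>verts = {..2 * n},
     edges = (\<lambda>k. {k, Suc k}) ` {..<n} \<union> (\<lambda>(k, x). {k, x}) ` ({..n} \<times> {n<..2 * n}),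
     weight = (\<lambda>e. if Max e \<le> n then 1 else 4 * real n - 2 * real (Min e))\<rparr>"

lemma weighted_graph_fan_graph: "weighted_graph (fan_graph n)"
  by (auto simp: weighted_graph_def fan_graph_def)

lemma fan_graph_edge_cases:
  assumes "{u, v} \<in> edges (fan_graph n)"
  obtains (path_up) "v = Suc u" "u < n" "weight (fan_graph n) {u, v} = 1"
  | (path_down) "u = Suc v" "v < n" "weight (fan_graph n) {u, v} = 1"
  | (spoke_out) "u \<le> n" "n < v" "v \<le> 2 * n" "weight (fan_graph n) {u, v} = 4 * real n - 2 * real u"
  | (spoke_in) "v \<le> n" "n < u" "u \<le> 2 * n" "weight (fan_graph n) {u, v} = 4 * real n - 2 * real v"
  using assms by (auto simp: fan_graph_def doubleton_eq_iff split: if_splits)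

lemma gdist_fan_graph_le:
  assumes "j < n" "n < x" "x \<le> 2 * n"
  shows "gdist (del_edges (fan_graph n) {{j, Suc j}}) 0 x \<le> ereal (4 * real n - real j)"
proof -
  let ?G = "del_edges (fan_graph n) {{j, Suc j}}"
  \<comment> \<open>Up to \<open>j\<close> the path avoids the failed edge; the spoke
    \<open>{j, x}\<close> then brings the total to j + (4n - 2j) = 4n - j.\<close>
  have "walk ?G 0 [0..<Suc k] k \<and> walk_weight ?G [0..<Suc k] = real k" if "k \<le> j" for k
    using that
  proof (induction k)
    case 0
    then show ?case by (simp add: walk_def del_edges_def fan_graph_def)
  next
    case (Suc k)
    then have IH: "walk ?G 0 [0..<Suc k] k" "walk_weight ?G [0..<Suc k] = real k"
      by simp_all
    have "{k, Suc k} \<in> edges ?G" "Suc k \<in> verts ?G" "weight ?G {k, Suc k} = 1"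
      using Suc.prems assms by (auto simp: del_edges_def fan_graph_def doubleton_eq_iff)
    then show ?case
      using walk_append_single[OF IH(1)] IH(2)
        walk_weight_append_single[of "[0..<Suc k]" ?G "Suc k"] by simp
  qed
  from this[of j] have path: "walk ?G 0 [0..<Suc j] j" "walk_weight ?G [0..<Suc j] = real j"
    by simp_all
  have "{j, x} \<in> edges ?G" "x \<in> verts ?G" "weight ?G {j, x} = 4 * real n - 2 * real j"
    using assms by (auto simp: del_edges_def fan_graph_def doubleton_eq_iff)
  then have "walk ?G 0 ([0..<Suc j] @ [x]) x"
    and "walk_weight ?G ([0..<Suc j] @ [x]) = 4 * real n - real j"
    using walk_append_single[OF path(1)] path(2)
      walk_weight_append_single[of "[0..<Suc j]" ?G x] by simp_all
  then show ?thesis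
    unfolding gdist_def by (intro INF_lower2) auto
qed

lemma gdist_fan_graph_missing_spoke_ge:
  assumes "subgraph H (fan_graph n)" "{j, x} \<notin> edges H" "j < n" "n < x"
  shows "ereal (4 * real n - real j + 1) \<le> gdist (del_edges H {{j, Suc j}}) 0 x"
proof -
  \<comment> \<open>The path up to \<open>j\<close> and the far ends other than \<open>x\<close> get
    their distance from 0. On a spoke from \<open>u \<le> j\<close> to \<open>x\<close>, the bound
    amounts to \<open>u + 1 \<le> j\<close>, which fails only for the missing spoke
    \<open>{j, x}\<close>. The value 3n beyond \<open>j\<close> has slack: spokes weigh at least 2n,
    and the only path edge where \<phi> jumps is the failed one.\<close>
  define \<phi> :: "nat \<Rightarrow> real" where
    "\<phi> v = (if v \<le> j then real v else if v \<le> n then 3 * real n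
           else if v = x then 4 * real n - real j + 1 else 4 * real n - real j)" for v
  have "\<phi> v - \<phi> u \<le> weight H {u, v}"
    if "{u, v} \<in> edges H" "{u, v} \<noteq> {j, Suc j}" for u v
  proof -
    have G: "{u, v} \<in> edges (fan_graph n)" "weight H {u, v} = weight (fan_graph n) {u, v}"
      using assms(1) that(1) unfolding subgraph_def by blast+
    have ne: "{u, v} \<noteq> {j, x}"
      using assms(2) that(1) by metis
    have "\<phi> v - \<phi> u \<le> weight (fan_graph n) {u, v}"
      using G(1)
    proof (cases rule: fan_graph_edge_cases)
      case path_up
      then have "u \<noteq> j" using that(2) by auto
      with path_up show ?thesis
        by (cases "u < j") (simp_all add: \<phi>_def)
    next
      case path_down
      then have "v \<noteq> j" using that(2) by (auto simp: insert_commute)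
      with path_down show ?thesis
        by (cases "v < j") (simp_all add: \<phi>_def)
    next
      case spoke_out
      then have "u \<noteq> j \<or> v \<noteq> x" using ne by auto
      with spoke_out assms(3) show ?thesis
        by (auto simp: \<phi>_def)
    next
      case spoke_in
      with assms(3) show ?thesis
        by (auto simp: \<phi>_def)
    qed
    then show ?thesis by (simp add: G(2))
  qed
  then have "ereal (\<phi> x - \<phi> 0) \<le> gdist (del_edges H {{j, Suc j}}) 0 x"
    by (intro potential_le_gdist) (auto simp: del_edges_def)
  then show ?thesis
    using assms(3,4) by (simp add: \<phi>_def)
qed

text \<open>Without the spoke, the two distance bounds differ by 1 once \<open>{j, Suc j}\<close>
  fails. The case \<open>j = n\<close> is left out because no path edge follows it.\<close>

lemma spoke_in_preserver:
  assumes "ft_pairwise_preserver 1 (fan_graph n) P H" "(0, x) \<in> P" "j < n" "n < x" "x \<le> 2 * n"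
  shows "{j, x} \<in> edges H"
proof (rule ccontr)
  assume "{j, x} \<notin> edges H"
  moreover have "subgraph H (fan_graph n)"
    using assms(1) by (simp add: ft_pairwise_preserver_def)
  ultimately have "ereal (4 * real n - real j + 1) \<le> gdist (del_edges H {{j, Suc j}}) 0 x"
    using assms by (intro gdist_fan_graph_missing_spoke_ge) auto
  also have "{{j, Suc j}} \<subseteq> edges (fan_graph n)"
    using assms(3) by (auto simp: fan_graph_def)
  then have "gdist (del_edges H {{j, Suc j}}) 0 x
      = gdist (del_edges (fan_graph n) {{j, Suc j}}) 0 x"
    using assms(1,2) by (fastforce simp: ft_pairwise_preserver_def)
  also have "\<dots> \<le> ereal (4 * real n - real j)"
    using assms by (intro gdist_fan_graph_le)
  finally show False by simp
qed

lemma card_edges_preserver_ge: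
  assumes "ft_pairwise_preserver 1 (fan_graph n) P H" "{0} \<times> {n<..n + m} \<subseteq> P" "m \<le> n"
  shows "n * m \<le> card (edges H)"
proof -
  let ?S = "{..<n} \<times> {n<..n + m}"
  \<comment> \<open>Finiteness matters, as \<open>card\<close> of an infinite set is 0.\<close>
  have "edges H \<subseteq> Pow (verts H)" "finite (verts H)"
    using assms(1) by (auto simp: ft_pairwise_preserver_def subgraph_def weighted_graph_def)
  then have "finite (edges H)"
    by (meson finite_Pow_iff finite_subset)
  moreover have "(\<lambda>(j, x). {j, x}) ` ?S \<subseteq> edges H"
    using assms(2,3) by (auto intro!: spoke_in_preserver[OF assms(1)])
  \<comment> \<open>The two ends of a spoke lie on different sides of \<open>n\<close>, so the
    unordered edge determines \<open>(j, x)\<close>.\<close>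
  moreover have "inj_on (\<lambda>(j, x). {j, x}) ?S"
    by (auto simp: inj_on_def doubleton_eq_iff)
  ultimately have "card ?S \<le> card (edges H)"
    by (metis card_image card_mono)
  then show ?thesis by (simp add: card_cartesian_product)
qed

theorem theorem8:
  "\<exists>a b c :: real. 0 < a \<and> 0 < b \<and> 0 < c \<and>
    (\<forall>n p :: nat. 1 \<le> p \<and> p \<le> n choose 2 \<longrightarrow>
      (\<exists>(G :: nat wgraph) P.
         weighted_graph G \<and>
         a * real n \<le> real (card (verts G)) \<and> real (card (verts G)) \<le> b * real n \<and>
         node_pairs G P \<and> card P = p \<and>
         (\<forall>H. ft_pairwise_preserver 1 G P H \<longrightarrow>
            c * real (min (n * p) (n ^ 2)) \<le> real (card (edges H)))))"
proof (rule exI[of _ 2], rule exI[of _ 3], rule exI[of _ 1], intro conjI allI impI)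
  fix n p :: nat
  assume p: "1 \<le> p \<and> p \<le> n choose 2"
  then have "n \<ge> 1"
    by (cases n) (auto simp: binomial_eq_0)
  \<comment> \<open>Only \<open>n\<close> far ends exist, so at most \<open>n\<close> pairs
    \<open>(0, x)\<close> do the forcing. The rest of \<open>P\<close> is padding from
    \<open>?T\<close>, whose pairs all lead from the path to a far end and hence never occur in both
    orientations.\<close>
  define m where "m = min p n"
  let ?T = "{..n} \<times> {n<..2 * n}"
  have "n choose 2 \<le> n * (n - 1)"
    by (simp add: choose_two)
  also have "\<dots> \<le> card ?T"
    by (simp add: card_cartesian_product diff_le_self trans_le_add2)
  finally have "p \<le> card ?T" using p by simp
  moreover have "card ({0} \<times> {n<..n + m}) \<le> p"
    by (simp add: card_cartesian_product m_def)
  moreover have "{0} \<times> {n<..n + m} \<subseteq> ?T"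
    by (auto simp: m_def)
  ultimately obtain P where P: "{0} \<times> {n<..n + m} \<subseteq> P" "P \<subseteq> ?T" "card P = p"
    using exists_subset_between[of "{0} \<times> {n<..n + m}" p ?T] by auto
  have "P \<subseteq> verts (fan_graph n) \<times> verts (fan_graph n)"
    by (rule subset_trans[OF P(2)]) (auto simp: fan_graph_def)
  moreover have "s \<noteq> t \<and> (t, s) \<notin> P" if "(s, t) \<in> P" for s t
    using subsetD[OF P(2), of "(s, t)"] subsetD[OF P(2), of "(t, s)"] that by auto
  ultimately have "node_pairs (fan_graph n) P"
    unfolding node_pairs_def by blast
  moreover have "1 * real (min (n * p) (n ^ 2)) \<le> real (card (edges H))"
    if "ft_pairwise_preserver 1 (fan_graph n) P H" for H
  proof -
    have "min (n * p) (n ^ 2) = n * m"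
      by (simp add: m_def power2_eq_square nat_mult_min_right)
    also have "\<dots> \<le> card (edges H)"
      using that P(1) by (intro card_edges_preserver_ge) (auto simp: m_def)
    finally show ?thesis by simp
  qed
  \<comment> \<open>This is at most 3n because \<open>n \<ge> 1\<close>.\<close>
  moreover have "card (verts (fan_graph n)) = 2 * n + 1"
    by (simp add: fan_graph_def)
  ultimately show "\<exists>(G :: nat wgraph) P. weighted_graph G \<and>
      2 * real n \<le> real (card (verts G)) \<and> real (card (verts G)) \<le> 3 * real n \<and>
      node_pairs G P \<and> card P = p \<and>
      (\<forall>H. ft_pairwise_preserver 1 G P H \<longrightarrow>
        1 * real (min (n * p) (n ^ 2)) \<le> real (card (edges H)))"
    using P(3) \<open>n \<ge> 1\<close> weighted_graph_fan_graph
    by (intro exI[of _ "fan_graph n"] exI[of _ P]) auto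
qed simp_all

end
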